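(* Let $\Omega\subseteq\mathbb{R}^n$ be nonempty, closed and convex, and let $f:\mathbb{R}^n\to\mathbb{R}$ be bounded below on $\Omega$ and continuously differentiable on $\Omega$, with gradient $g:=\nabla f$ satisfying $\|g(x)-g(y)\|\le L\|x-y\|$ for all $x,y\in\Omega$, where $L>0$ is a constant. Suppose there are constants $\epsilon_b>0$ and $\epsilon_g>0$ such that, for all $x\in\Omega$, the noisy function and gradient values satisfy $|\tilde f(x)-f(x)|\le\epsilon_b$ and $\|\tilde g(x)-g(x)\|\le\epsilon_g$. Let $\{x_k\}$ be the iterates generated by the line search gradient projection method GP-LS (described in the context) with parameters $\rho\in(0,1)$, $c\in(0,1)$, $\alpha_0>0$, constant relaxation $\epsilon_A$, and initial point $x_0\in\Omega$. If $\alpha_0+2c<1$ and $\epsilon_A>\epsilon_b$, then $$\liminf_{k\to\infty}\left|p_k^Tg_k\right|\le\bar\epsilon,$$ where $g_k:=g(x_k)$, $p_k:=P_\Omega[x_k-\alpha_0 g_k]-x_k$, $$\bar\epsilon:=\frac{\epsilon_g^2}{\gamma^2}+\frac{2\alpha_0L}{c\rho\left(\frac12-\frac{\alpha_0}{2}-\left(\frac{3\alpha_0}{2}+\frac12\right)\gamma^2\right)}\left(\epsilon_A+\epsilon_b\right),$$ and $$\gamma^2:=\frac{(1-2c-\alpha_0)(1-\alpha_0)}{(1-2c-\alpha_0)(3\alpha_0+1)+2}.$$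
   Context: The norm $\|\cdot\|$ is the Euclidean norm, and $P_\Omega[\cdot]$ is the Euclidean projection onto $\Omega$. The problem is $\min_{x\in\Omega} f(x)$. Noisy evaluations: $\tilde f(x)$ and $\tilde g(x)$ denote noisy approximations of $f(x)$ and $g(x)$. The noise may be deterministic or stochastic (so repeated evaluations at the same point may differ); the bounds in the claim are assumed to hold for every evaluation at every point of $\Omega$. Write $\tilde g_k$ for the noisy gradient computed at $x_k$. Method GP-LS (line search gradient projection method). Inputs: initial point $x_0$, constants $\rho\in(0,1)$, $c\in(0,1)$, initial trial steplength $\alpha_0>0$, and relaxation $\epsilon_A$. For $k=0,1,2,\dots$ (the method is run without termination, producing an infinite sequence): 1. Compute a noisy gradient $\tilde g_k$ at $x_k$. 2. Set $\tilde p_k:=P_\Omega[x_k-\alpha_0\tilde g_k]-x_k$. 3. Set $\beta_k:=1$; while $\tilde f(x_k+\beta_k\tilde p_k)>\tilde f(x_k)+c\beta_k\tilde g_k^T\tilde p_k+2\epsilon_A$, replace $\beta_k$ by $\rho\beta_k$. 4. Set $x_{k+1}:=x_k+\beta_k\tilde p_k$. *)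

theory Defs
  imports "HOL-Analysis.Analysis" "HOL-Library.While_Combinator"
begin

text \<open>
  Noisy evaluations of the objective are modelled by an oracle
  \<open>ft :: f_eval \<Rightarrow> 'a \<Rightarrow> real\<close>: repeated evaluations at one point carry different labels and
  so may return different values. The \<open>j\<close>-th line search test of iteration \<open>k\<close>
  uses the value labelled \<open>Base k j\<close> at the current iterate and the value labelled
  \<open>Trial k j\<close> at the trial point; \<open>ft (Base k j)\<close> independent of \<open>j\<close> is the case where the
  value at the iterate is computed once per iteration. Stochastic or history-dependent noise
  is covered realization by realization.
\<close>

datatype f_eval = Base nat nat | Trial nat nat

definition gp_direction :: "'a::euclidean_space set \<Rightarrow> real \<Rightarrow> 'a \<Rightarrow> 'a \<Rightarrow> 'a" where
  "gp_direction \<Omega> \<alpha> x d = closest_point \<Omega> (x - \<alpha> *\<^sub>R d) - x"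

text \<open>
  The counter \<open>j\<close> only labels the evaluations. Termination is not built in: if the
  loop diverges, the result is unspecified.
\<close>

definition gpls_steplength ::
  "(f_eval \<Rightarrow> 'a::euclidean_space \<Rightarrow> real) \<Rightarrow> real \<Rightarrow> real \<Rightarrow> real \<Rightarrow> nat \<Rightarrow> 'a \<Rightarrow> 'a \<Rightarrow> 'a \<Rightarrow> real" where
  "gpls_steplength ft \<rho> c \<epsilon>A k x d p =
     snd (while
       (\<lambda>(j, \<beta>). ft (Trial k j) (x + \<beta> *\<^sub>R p) > ft (Base k j) x + c * \<beta> * (d \<bullet> p) + 2 * \<epsilon>A)
       (\<lambda>(j, \<beta>). (Suc j, \<rho> * \<beta>))
       (0, 1))"

primrec gpls_iterate ::
  "'a::euclidean_space set \<Rightarrow> (f_eval \<Rightarrow> 'a \<Rightarrow> real) \<Rightarrow> (nat \<Rightarrow> 'a \<Rightarrow> 'a) \<Rightarrow>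
   real \<Rightarrow> real \<Rightarrow> real \<Rightarrow> real \<Rightarrow> 'a \<Rightarrow> nat \<Rightarrow> 'a" where
  "gpls_iterate \<Omega> ft gt \<rho> c \<alpha>0 \<epsilon>A x0 0 = x0"
| "gpls_iterate \<Omega> ft gt \<rho> c \<alpha>0 \<epsilon>A x0 (Suc k) =
     (let x = gpls_iterate \<Omega> ft gt \<rho> c \<alpha>0 \<epsilon>A x0 k;
          d = gt k x;
          p = gp_direction \<Omega> \<alpha>0 x d;
          \<beta> = gpls_steplength ft \<rho> c \<epsilon>A k x d p
      in x + \<beta> *\<^sub>R p)"

end

theory Submission imports Defs begin

text \<open>
  Write \<open>d\<close> for the noisy gradient at an iterate \<open>x\<close>, \<open>p'\<close> for the direction it defines,
  \<open>p\<close> for the direction of the exact gradient \<open>g x\<close>, and put \<open>q = - d \<bullet> p'\<close>, \<open>r = - g x \<bullet> p\<close>.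
  Both are nonnegative, by the variational inequality of the projection. The argument is by
  contradiction: if \<open>r\<close> is eventually larger than the bound of the theorem, then each later
  step decreases \<open>f\<close> itself by at least a fixed positive amount, and \<open>f\<close> is bounded below.

  \<^item> Optimality of \<open>p'\<close> tested against \<open>p\<close> gives \<open>q \<ge> (1 - \<alpha>) / 2 * r - \<epsilon>\<^sup>2 / 2\<close>
    (\<open>gp_direction_perturbation\<close>). With \<open>\<gamma>\<^sup>2\<close> as in the theorem, \<open>r \<ge> \<epsilon>\<^sup>2 / \<gamma>\<^sup>2\<close> turns
    this into \<open>q \<ge> \<kappa> * r\<close> for a constant \<open>\<kappa> > 0\<close>, and \<open>\<gamma>\<^sup>2\<close> is chosen such that also
    \<open>(1 - 2 * c - \<alpha>) * q \<ge> \<epsilon>\<^sup>2\<close>.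
  \<^item> The latter inequality and the descent lemma show that each steplength
    \<open>\<beta> \<le> 1 / (\<alpha> * L)\<close> decreases the exact function by \<open>c * \<beta> * q\<close>
    (\<open>sufficient_decrease\<close>). As \<open>\<epsilon>A > \<epsilon>b\<close>, the noisy test accepts such a step, so
    backtracking ends with \<open>\<beta> = 1\<close> or \<open>\<beta> > \<rho> / (\<alpha> * L)\<close>.
  \<^item> If the accepted steplength is at most \<open>1 / (\<alpha> * L)\<close>, the exact decrease is
    \<open>c * \<beta> * q\<close> and noise in the function does not enter. This covers in particular
    \<open>\<beta> = 1\<close> with \<open>\<alpha> * L\<close> small. If \<open>\<beta> > 1 / (\<alpha> * L)\<close>, the accepted test only guarantees
    a decrease of \<open>c * \<beta> * q - 2 * (\<epsilon>A + \<epsilon>b)\<close>, and the second summand of the bound makes this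
    exceed \<open>2 * (\<epsilon>A + \<epsilon>b) * (1 / \<rho> - 1) > 0\<close> (\<open>line_search_progress\<close>).
\<close>

section \<open>Descent lemma\<close>

lemma descent_lemma:
  fixes f :: "'a::euclidean_space \<Rightarrow> real"
  assumes "convex S"
    and grad: "\<And>x. x \<in> S \<Longrightarrow> GDERIV f x :> g x"
    and lip: "\<And>x y. x \<in> S \<Longrightarrow> y \<in> S \<Longrightarrow> norm (g x - g y) \<le> L * norm (x - y)"
    and x: "x \<in> S" and y: "x + v \<in> S"
  shows "f (x + v) \<le> f x + g x \<bullet> v + L / 2 * (norm v)\<^sup>2"
proof -
  let ?\<phi> = "\<lambda>t. f (x + t *\<^sub>R v) - t * (g x \<bullet> v) - L / 2 * t\<^sup>2 * (norm v)\<^sup>2"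
  have "?\<phi> 1 \<le> ?\<phi> 0"
  proof (rule DERIV_nonpos_imp_nonincreasing[where f = ?\<phi>])
    fix t :: real assume t: "0 \<le> t" "t \<le> 1"
    have "(1 - t) *\<^sub>R x + t *\<^sub>R (x + v) \<in> S"
      using convexD_alt[OF \<open>convex S\<close> x y, of t] t by simp
    then have z: "x + t *\<^sub>R v \<in> S"
      by (simp add: algebra_simps)
    have "(f has_derivative (\<lambda>h. h \<bullet> g (x + t *\<^sub>R v))) (at (x + t *\<^sub>R v))"
      using grad[OF z] by (simp add: gderiv_def)
    moreover have "((\<lambda>s. x + s *\<^sub>R v) has_derivative (\<lambda>s. s *\<^sub>R v)) (at t)"
      by (auto intro!: derivative_eq_intros)
    ultimately have "((\<lambda>s. f (x + s *\<^sub>R v)) has_derivative (\<lambda>s. (s *\<^sub>R v) \<bullet> g (x + t *\<^sub>R v))) (at t)"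
      by (rule has_derivative_compose[rotated])
    then have "((\<lambda>s. f (x + s *\<^sub>R v)) has_real_derivative g (x + t *\<^sub>R v) \<bullet> v) (at t)"
      by (rule has_derivative_imp_has_field_derivative) (simp add: inner_commute)
    then have "(?\<phi> has_real_derivative
        g (x + t *\<^sub>R v) \<bullet> v - g x \<bullet> v - L * t * (norm v)\<^sup>2) (at t)"
      by (auto intro!: derivative_eq_intros)
    moreover have "g (x + t *\<^sub>R v) \<bullet> v - g x \<bullet> v - L * t * (norm v)\<^sup>2 \<le> 0"
    proof -
      have "(g (x + t *\<^sub>R v) - g x) \<bullet> v \<le> norm (g (x + t *\<^sub>R v) - g x) * norm v"
        by (rule norm_cauchy_schwarz)
      also have "\<dots> \<le> (L * norm (t *\<^sub>R v)) * norm v"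
        using lip[OF z x] by (intro mult_right_mono) auto
      also have "\<dots> = L * t * (norm v)\<^sup>2"
        using t by (simp add: power2_eq_square)
      finally show ?thesis by (simp add: inner_diff_left)
    qed
    ultimately show "\<exists>D. (?\<phi> has_real_derivative D) (at t) \<and> D \<le> 0" by blast
  qed simp
  then show ?thesis by simp
qed

section \<open>Gradient projection directions\<close>

context
  fixes \<Omega> :: "'a::euclidean_space set"
  assumes conv: "convex \<Omega>" and clsd: "closed \<Omega>"
begin

lemma gp_direction_feasible:
  assumes "x \<in> \<Omega>"
  shows "x + gp_direction \<Omega> \<alpha> x d \<in> \<Omega>"
  using closest_point_in_set[OF clsd, of "x - \<alpha> *\<^sub>R d"] assms by (auto simp: gp_direction_def)

lemma gp_direction_segment:
  assumes x: "x \<in> \<Omega>" and "0 \<le> \<beta>" "\<beta> \<le> 1"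
  shows "x + \<beta> *\<^sub>R gp_direction \<Omega> \<alpha> x d \<in> \<Omega>"
proof -
  have "(1 - \<beta>) *\<^sub>R x + \<beta> *\<^sub>R (x + gp_direction \<Omega> \<alpha> x d) \<in> \<Omega>"
    using convexD_alt[OF conv x gp_direction_feasible[OF x]] assms by simp
  then show ?thesis by (simp add: algebra_simps)
qed

lemma gp_direction_variational:
  assumes "x + v \<in> \<Omega>"
  shows "0 \<le> (\<alpha> *\<^sub>R d + gp_direction \<Omega> \<alpha> x d) \<bullet> (v - gp_direction \<Omega> \<alpha> x d)"
  using closest_point_dot[OF conv clsd assms, of "x - \<alpha> *\<^sub>R d"]
  by (simp add: gp_direction_def inner_simps algebra_simps)

lemma gp_direction_descent:
  assumes "x \<in> \<Omega>"
  shows "(norm (gp_direction \<Omega> \<alpha> x d))\<^sup>2 \<le> \<alpha> * - (d \<bullet> gp_direction \<Omega> \<alpha> x d)"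
  using gp_direction_variational[of x 0 \<alpha> d] assms
  by (simp add: power2_norm_eq_inner inner_simps)

text \<open>
  The noisy direction \<open>p'\<close> is optimal for the model built from \<open>d\<close>, so it does at least as well
  there as the exact direction \<open>p\<close>, whose value in that model differs from its value in the exact
  model only by \<open>(d - g) \<bullet> p\<close>. Young's inequality and \<open>gp_direction_descent\<close> absorb this error.
\<close>

lemma gp_direction_perturbation:
  assumes x: "x \<in> \<Omega>" and "0 < \<alpha>" and err: "norm (d - g) \<le> \<epsilon>"
  defines "p \<equiv> gp_direction \<Omega> \<alpha> x g" and "p' \<equiv> gp_direction \<Omega> \<alpha> x d"
  shows "(1 - \<alpha>) / 2 * - (g \<bullet> p) - \<epsilon>\<^sup>2 / 2 \<le> - (d \<bullet> p')"
proof -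
  have "0 \<le> (\<alpha> *\<^sub>R d + p') \<bullet> (p - p')"
    unfolding p_def p'_def by (intro gp_direction_variational gp_direction_feasible x)
  then have opt: "0 \<le> \<alpha> * (d \<bullet> p) - \<alpha> * (d \<bullet> p') + p' \<bullet> p - (norm p')\<^sup>2"
    by (simp add: inner_simps power2_norm_eq_inner algebra_simps)
  have "0 \<le> (norm (p - p'))\<^sup>2" by simp
  then have "2 * (p' \<bullet> p) \<le> (norm p)\<^sup>2 + (norm p')\<^sup>2"
    by (simp add: power2_norm_eq_inner inner_simps inner_commute)
  then have "2 * (\<alpha> * (d \<bullet> p')) \<le> 2 * (\<alpha> * (d \<bullet> p)) + (norm p)\<^sup>2"
    using opt zero_le_power2[of "norm p'"] by linarith
  moreover have desc: "(norm p)\<^sup>2 \<le> \<alpha> * - (g \<bullet> p)"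
    unfolding p_def by (rule gp_direction_descent[OF x])
  ultimately have "\<alpha> * (2 * (d \<bullet> p')) \<le> \<alpha> * (2 * (d \<bullet> p) - g \<bullet> p)"
    by (simp add: algebra_simps)
  then have 1: "2 * (d \<bullet> p') \<le> 2 * (d \<bullet> p) - g \<bullet> p"
    using \<open>0 < \<alpha>\<close> by simp
  have "(d - g) \<bullet> p \<le> norm (d - g) * norm p" by (rule norm_cauchy_schwarz)
  also have "\<dots> \<le> \<epsilon> * norm p" using err by (simp add: mult_right_mono)
  finally have "2 * ((d - g) \<bullet> p) \<le> \<epsilon>\<^sup>2 + (norm p)\<^sup>2"
    using sum_squares_bound[of \<epsilon> "norm p"] by linarith
  then have "2 * (d \<bullet> p) \<le> 2 * (g \<bullet> p) + \<epsilon>\<^sup>2 + \<alpha> * - (g \<bullet> p)"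
    using desc by (simp add: inner_diff_left)
  with 1 show ?thesis by (simp add: field_simps)
qed

section \<open>Exact decrease for short steps\<close>

text \<open>
  Compared with the noise-free estimate, the descent lemma has the extra term
  \<open>\<epsilon> * norm p \<le> (\<epsilon>\<^sup>2 + (norm p)\<^sup>2) / 2\<close>, and \<open>(norm p)\<^sup>2 \<le> \<alpha> * q\<close>. For
  \<open>\<beta> \<le> 1 / (\<alpha> * L)\<close> the curvature term costs at most \<open>q / 2\<close>, so a fraction
  \<open>1 / 2 - \<alpha> / 2\<close> of \<open>q\<close> remains to pay for \<open>\<epsilon>\<^sup>2 / 2\<close> and the Armijo fraction \<open>c\<close>.
\<close>

lemma sufficient_decrease:
  assumes grad: "\<And>x. x \<in> \<Omega> \<Longrightarrow> GDERIV f x :> g x"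
    and lip: "\<And>x y. x \<in> \<Omega> \<Longrightarrow> y \<in> \<Omega> \<Longrightarrow> norm (g x - g y) \<le> L * norm (x - y)"
    and "0 < L" and "0 < \<alpha>" and x: "x \<in> \<Omega>" and err: "norm (d - g x) \<le> \<epsilon>"
  defines "p \<equiv> gp_direction \<Omega> \<alpha> x d"
  assumes big: "\<epsilon>\<^sup>2 \<le> (1 - 2 * c - \<alpha>) * - (d \<bullet> p)"
    and \<beta>: "0 \<le> \<beta>" "\<beta> \<le> 1" "\<beta> * (\<alpha> * L) \<le> 1"
  shows "f (x + \<beta> *\<^sub>R p) \<le> f x + c * \<beta> * (d \<bullet> p)"
proof -
  have desc: "(norm p)\<^sup>2 \<le> \<alpha> * - (d \<bullet> p)"
    unfolding p_def by (rule gp_direction_descent[OF x])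
  then have q: "0 \<le> - (d \<bullet> p)"
    using \<open>0 < \<alpha>\<close> zero_le_power2[of "norm p"] by (metis order_trans zero_le_mult_iff not_less)
  have "f (x + \<beta> *\<^sub>R p) \<le> f x + g x \<bullet> (\<beta> *\<^sub>R p) + L / 2 * (norm (\<beta> *\<^sub>R p))\<^sup>2"
    using grad lip gp_direction_segment[OF x] \<beta> unfolding p_def
    by (intro descent_lemma[OF conv] x) auto
  then have 1: "f (x + \<beta> *\<^sub>R p) \<le> f x + \<beta> * (g x \<bullet> p + L / 2 * \<beta> * (norm p)\<^sup>2)"
    by (simp add: power_mult_distrib power2_eq_square algebra_simps)
  have "(g x - d) \<bullet> p \<le> norm (g x - d) * norm p" by (rule norm_cauchy_schwarz)
  also have "\<dots> \<le> \<epsilon> * norm p" using err by (simp add: mult_right_mono norm_minus_commute)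
  finally have "2 * ((g x - d) \<bullet> p) \<le> \<epsilon>\<^sup>2 + (norm p)\<^sup>2"
    using sum_squares_bound[of \<epsilon> "norm p"] by linarith
  then have 2: "2 * (g x \<bullet> p) \<le> 2 * (d \<bullet> p) + \<epsilon>\<^sup>2 + (norm p)\<^sup>2"
    by (simp add: inner_diff_left)
  have "L * \<beta> * (norm p)\<^sup>2 \<le> L * \<beta> * (\<alpha> * - (d \<bullet> p))"
    using desc \<open>0 < L\<close> \<beta> by (intro mult_left_mono) auto
  also have "\<dots> = (\<beta> * (\<alpha> * L)) * - (d \<bullet> p)" by simp
  also have "\<dots> \<le> 1 * - (d \<bullet> p)" using q \<beta> by (intro mult_right_mono) auto
  finally have "L * \<beta> * (norm p)\<^sup>2 \<le> - (d \<bullet> p)" by simp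
  with 2 big desc have "g x \<bullet> p + L / 2 * \<beta> * (norm p)\<^sup>2 \<le> c * (d \<bullet> p)"
    by (simp add: algebra_simps)
  then have "\<beta> * (g x \<bullet> p + L / 2 * \<beta> * (norm p)\<^sup>2) \<le> \<beta> * (c * (d \<bullet> p))"
    using \<beta> by (intro mult_left_mono) auto
  with 1 show ?thesis by (simp add: algebra_simps)
qed

end

section \<open>The backtracking loop\<close>

lemma gpls_steplength_least:
  fixes ft :: "f_eval \<Rightarrow> 'a::euclidean_space \<Rightarrow> real" and x p d :: 'a
    and \<rho> c \<epsilon>A :: real and k n :: nat
  defines "acc \<equiv> (\<lambda>j.
    ft (Trial k j) (x + \<rho> ^ j *\<^sub>R p) \<le> ft (Base k j) x + c * \<rho> ^ j * (d \<bullet> p) + 2 * \<epsilon>A)"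
  assumes "acc n"
  obtains m where "gpls_steplength ft \<rho> c \<epsilon>A k x d p = \<rho> ^ m" and "acc m"
    and "\<And>i. i < m \<Longrightarrow> \<not> acc i"
proof -
  let ?b = "\<lambda>(j, \<beta>). ft (Trial k j) (x + \<beta> *\<^sub>R p) > ft (Base k j) x + c * \<beta> * (d \<bullet> p) + 2 * \<epsilon>A"
  let ?s = "\<lambda>(j, \<beta>). (Suc j, \<rho> * \<beta>)"
  have pow: "(?s ^^ j) (0, 1) = (j, \<rho> ^ j)" for j
    by (induction j) auto
  have b: "\<not> ?b ((?s ^^ j) (0, 1)) \<longleftrightarrow> acc j" for j
    by (simp add: pow acc_def not_less)
  let ?m = "LEAST j. acc j"
  have "while_option ?b ?s (0, 1) = Some (?m, \<rho> ^ ?m)"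
    using assms(2) unfolding while_option_def b by (auto simp: pow)
  then have "gpls_steplength ft \<rho> c \<epsilon>A k x d p = \<rho> ^ ?m"
    by (simp add: gpls_steplength_def while_def)
  then show thesis
    using that[of ?m] LeastI[of acc, OF assms(2)] not_less_Least by blast
qed

text \<open>
  The relaxation \<open>2 * \<epsilon>A\<close> dominates the noise in the difference of two function values, so
  by continuity of \<open>f\<close> the difference of the two sides of the test is eventually negative as
  the steplength tends to zero.
\<close>

lemma backtracking_terminates:
  fixes f :: "'a::euclidean_space \<Rightarrow> real"
  assumes cont: "isCont f x"
    and noise: "\<And>e y. y \<in> \<Omega> \<Longrightarrow> \<bar>ft e y - f y\<bar> \<le> \<epsilon>b" and "\<epsilon>b < \<epsilon>A"
    and "0 < \<rho>" "\<rho> < 1" and "x \<in> \<Omega>" and seg: "\<And>j. x + \<rho> ^ j *\<^sub>R p \<in> \<Omega>"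
  shows "\<exists>j. ft (Trial k j) (x + \<rho> ^ j *\<^sub>R p) \<le> ft (Base k j) x + c * \<rho> ^ j * (d \<bullet> p) + 2 * \<epsilon>A"
proof -
  have \<rho>0: "(\<lambda>j. \<rho> ^ j) \<longlonglongrightarrow> 0"
    using \<open>0 < \<rho>\<close> \<open>\<rho> < 1\<close> by (intro LIMSEQ_realpow_zero) auto
  have "(\<lambda>j. x + \<rho> ^ j *\<^sub>R p) \<longlonglongrightarrow> x + 0 *\<^sub>R p"
    by (intro tendsto_intros \<rho>0)
  then have "(\<lambda>j. f (x + \<rho> ^ j *\<^sub>R p)) \<longlonglongrightarrow> f x"
    using isCont_tendsto_compose[OF cont] by simp
  then have "(\<lambda>j. f (x + \<rho> ^ j *\<^sub>R p) - f x - c * \<rho> ^ j * (d \<bullet> p)) \<longlonglongrightarrow> f x - f x - c * 0 * (d \<bullet> p)"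
    by (intro tendsto_intros \<rho>0)
  then have "\<forall>\<^sub>F j in sequentially. f (x + \<rho> ^ j *\<^sub>R p) - f x - c * \<rho> ^ j * (d \<bullet> p) < 2 * (\<epsilon>A - \<epsilon>b)"
    by (rule order_tendstoD) (use \<open>\<epsilon>b < \<epsilon>A\<close> in simp)
  then obtain j where "f (x + \<rho> ^ j *\<^sub>R p) - f x - c * \<rho> ^ j * (d \<bullet> p) < 2 * (\<epsilon>A - \<epsilon>b)"
    by (auto simp: eventually_sequentially)
  with noise[OF seg, of "Trial k j" j] noise[OF \<open>x \<in> \<Omega>\<close>, of "Base k j"] show ?thesis
    by (intro exI[of _ j]) (simp add: abs_le_iff)
qed

section \<open>Progress of one iteration\<close>

text \<open>
  Away from the neighbourhood of stationarity described by \<open>big\<close>, backtracking stops at the latest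
  at the first trial steplength of at most \<open>1 / (\<alpha> * L)\<close>. The two sides of the minimum belong
  to accepted steplengths of at most and of more than \<open>1 / (\<alpha> * L)\<close>: on the short side the
  decrease comes from \<open>sufficient_decrease\<close>, on the long side from the noisy test.
\<close>

lemma line_search_progress:
  fixes \<Omega> :: "'a::euclidean_space set"
  assumes conv: "convex \<Omega>" and clsd: "closed \<Omega>"
    and grad: "\<And>x. x \<in> \<Omega> \<Longrightarrow> GDERIV f x :> g x"
    and lip: "\<And>x y. x \<in> \<Omega> \<Longrightarrow> y \<in> \<Omega> \<Longrightarrow> norm (g x - g y) \<le> L * norm (x - y)"
    and noise: "\<And>e y. y \<in> \<Omega> \<Longrightarrow> \<bar>ft e y - f y\<bar> \<le> \<epsilon>b" and "\<epsilon>b < \<epsilon>A"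
    and "0 < L" and "0 < \<alpha>" and "0 < \<rho>" "\<rho> < 1" and "0 < c"
    and x: "x \<in> \<Omega>" and err: "norm (d - g x) \<le> \<epsilon>"
  defines "p \<equiv> gp_direction \<Omega> \<alpha> x d"
  assumes big: "\<epsilon>\<^sup>2 \<le> (1 - 2 * c - \<alpha>) * - (d \<bullet> p)"
    and Q: "0 \<le> Q" "Q \<le> - (d \<bullet> p)"
  shows "f (x + gpls_steplength ft \<rho> c \<epsilon>A k x d p *\<^sub>R p)
    \<le> f x - min (c * min 1 (\<rho> / (\<alpha> * L)) * Q) (c * Q / (\<alpha> * L) - 2 * (\<epsilon>A + \<epsilon>b))"
proof -
  have aL: "0 < \<alpha> * L" using assms by simp
  have pow: "0 < \<rho> ^ j" "\<rho> ^ j \<le> 1" for j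
    using \<open>0 < \<rho>\<close> \<open>\<rho> < 1\<close> by (auto intro: power_le_one)
  have seg: "x + \<rho> ^ j *\<^sub>R p \<in> \<Omega>" for j
    unfolding p_def using pow by (intro gp_direction_segment conv clsd x) (auto simp: less_imp_le)
  have dec: "f (x + \<rho> ^ j *\<^sub>R p) \<le> f x + c * \<rho> ^ j * (d \<bullet> p)" if "\<rho> ^ j * (\<alpha> * L) \<le> 1" for j
    unfolding p_def using pow that big[unfolded p_def] assms
    by (intro sufficient_decrease[where L = L and \<epsilon> = \<epsilon> and g = g]) (auto simp: less_imp_le)
  have cont: "isCont f x"
    using grad[OF x] by (auto simp: gderiv_def intro: has_derivative_continuous)
  obtain n where "ft (Trial k n) (x + \<rho> ^ n *\<^sub>R p) \<le> ft (Base k n) x + c * \<rho> ^ n * (d \<bullet> p) + 2 * \<epsilon>A"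
    using backtracking_terminates[where ft = ft and \<Omega> = \<Omega>, OF cont noise \<open>\<epsilon>b < \<epsilon>A\<close> \<open>0 < \<rho>\<close> \<open>\<rho> < 1\<close> x seg]
    by blast
  then obtain m where step: "gpls_steplength ft \<rho> c \<epsilon>A k x d p = \<rho> ^ m"
    and acc: "ft (Trial k m) (x + \<rho> ^ m *\<^sub>R p) \<le> ft (Base k m) x + c * \<rho> ^ m * (d \<bullet> p) + 2 * \<epsilon>A"
    and rej: "\<And>i. i < m \<Longrightarrow>
      \<not> ft (Trial k i) (x + \<rho> ^ i *\<^sub>R p) \<le> ft (Base k i) x + c * \<rho> ^ i * (d \<bullet> p) + 2 * \<epsilon>A"
    by (rule gpls_steplength_least) blast
  show ?thesis
  proof (cases "\<rho> ^ m * (\<alpha> * L) \<le> 1")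
    case True
    have "min 1 (\<rho> / (\<alpha> * L)) \<le> \<rho> ^ m"
    proof (cases m)
      case (Suc i)
      (* The previous trial was rejected, which can only happen above 1 / (\<alpha> * L). *)
      have "\<not> \<rho> ^ i * (\<alpha> * L) \<le> 1"
        using rej[of i] dec[of i] Suc noise[OF seg, of "Trial k i" i] noise[OF x, of "Base k i"] \<open>\<epsilon>b < \<epsilon>A\<close>
        by (auto simp: abs_le_iff)
      then have "\<rho> * 1 \<le> \<rho> * (\<rho> ^ i * (\<alpha> * L))"
        using \<open>0 < \<rho>\<close> by (intro mult_left_mono) auto
      then have "\<rho> / (\<alpha> * L) \<le> \<rho> ^ m"
        using aL Suc by (simp add: pos_divide_le_eq mult.assoc)
      then show ?thesis by simp
    qed simp
    then have "min 1 (\<rho> / (\<alpha> * L)) * Q \<le> \<rho> ^ m * - (d \<bullet> p)"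
      using Q pow[of m] by (intro mult_mono) (auto simp: less_imp_le)
    then have "c * (min 1 (\<rho> / (\<alpha> * L)) * Q) \<le> c * (\<rho> ^ m * - (d \<bullet> p))"
      using \<open>0 < c\<close> by (intro mult_left_mono) auto
    then have "c * min 1 (\<rho> / (\<alpha> * L)) * Q \<le> - (c * \<rho> ^ m * (d \<bullet> p))"
      by (simp add: mult.assoc)
    with dec[OF True] have "f (x + \<rho> ^ m *\<^sub>R p) \<le> f x - c * min 1 (\<rho> / (\<alpha> * L)) * Q" by linarith
    then show ?thesis unfolding step by linarith
  next
    case False
    then have "1 / (\<alpha> * L) \<le> \<rho> ^ m"
      using aL by (simp add: pos_divide_le_eq)
    then have "1 / (\<alpha> * L) * Q \<le> \<rho> ^ m * - (d \<bullet> p)"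
      using Q pow[of m] by (intro mult_mono) (auto simp: less_imp_le)
    then have "c * (1 / (\<alpha> * L) * Q) \<le> c * (\<rho> ^ m * - (d \<bullet> p))"
      using \<open>0 < c\<close> by (intro mult_left_mono) auto
    then have "c * Q / (\<alpha> * L) \<le> - (c * \<rho> ^ m * (d \<bullet> p))"
      by (simp add: mult.assoc)
    moreover have "f (x + \<rho> ^ m *\<^sub>R p) \<le> f x + c * \<rho> ^ m * (d \<bullet> p) + 2 * (\<epsilon>A + \<epsilon>b)"
      using acc noise[OF seg, of "Trial k m" m] noise[OF x, of "Base k m"] by (simp add: abs_le_iff)
    ultimately have "f (x + \<rho> ^ m *\<^sub>R p) \<le> f x - (c * Q / (\<alpha> * L) - 2 * (\<epsilon>A + \<epsilon>b))" by linarith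
    then show ?thesis unfolding step by linarith
  qed
qed

lemma gpls_iterate_in_domain:
  fixes \<Omega> :: "'a::euclidean_space set"
  assumes conv: "convex \<Omega>" and clsd: "closed \<Omega>"
    and cont: "\<And>x. x \<in> \<Omega> \<Longrightarrow> isCont f x"
    and noise: "\<And>e y. y \<in> \<Omega> \<Longrightarrow> \<bar>ft e y - f y\<bar> \<le> \<epsilon>b" and "\<epsilon>b < \<epsilon>A"
    and "0 < \<rho>" "\<rho> < 1" and "x0 \<in> \<Omega>"
  shows "gpls_iterate \<Omega> ft gt \<rho> c \<alpha> \<epsilon>A x0 k \<in> \<Omega>"
proof (induction k)
  case (Suc k)
  let ?x = "gpls_iterate \<Omega> ft gt \<rho> c \<alpha> \<epsilon>A x0 k"
  let ?d = "gt k ?x"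
  let ?p = "gp_direction \<Omega> \<alpha> ?x ?d"
  have seg: "?x + \<rho> ^ j *\<^sub>R ?p \<in> \<Omega>" for j
    using \<open>0 < \<rho>\<close> \<open>\<rho> < 1\<close>
    by (intro gp_direction_segment conv clsd Suc) (auto intro: power_le_one)
  obtain n where "ft (Trial k n) (?x + \<rho> ^ n *\<^sub>R ?p) \<le> ft (Base k n) ?x + c * \<rho> ^ n * (?d \<bullet> ?p) + 2 * \<epsilon>A"
    using backtracking_terminates[where ft = ft and \<Omega> = \<Omega>,
        OF cont[OF Suc] noise \<open>\<epsilon>b < \<epsilon>A\<close> \<open>0 < \<rho>\<close> \<open>\<rho> < 1\<close> Suc seg] by blast
  then obtain m where "gpls_steplength ft \<rho> c \<epsilon>A k ?x ?d ?p = \<rho> ^ m"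
    by (rule gpls_steplength_least) blast
  with seg[of m] show ?case by (simp add: Let_def)
qed (use \<open>x0 \<in> \<Omega>\<close> in simp)

section \<open>Convergence to a neighbourhood of stationarity\<close>

lemma not_bdd_below_if_uniform_decrease:
  fixes u :: "nat \<Rightarrow> real"
  assumes "0 < \<eta>" and dec: "\<And>k. K \<le> k \<Longrightarrow> u (Suc k) \<le> u k - \<eta>"
  shows "\<not> bdd_below (range u)"
proof
  assume "bdd_below (range u)"
  then obtain B where B: "\<And>k. B \<le> u k" by (auto simp: bdd_below_def)
  have "u (K + n) \<le> u K - real n * \<eta>" for n
  proof (induction n)
    case (Suc n)
    with dec[of "K + n"] show ?case by (simp add: algebra_simps)
  qed simp
  moreover obtain n where "u K - B < real n * \<eta>"
    using reals_Archimedean3[OF \<open>0 < \<eta>\<close>] by blast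
  ultimately show False using B[of "K + n"] by (smt (verit))
qed

theorem theorem6p7:
  fixes \<Omega> :: "'a::euclidean_space set"
    and f :: "'a \<Rightarrow> real" and g :: "'a \<Rightarrow> 'a"
    and ft :: "f_eval \<Rightarrow> 'a \<Rightarrow> real" and gt :: "nat \<Rightarrow> 'a \<Rightarrow> 'a"
    and L \<epsilon>b \<epsilon>g \<epsilon>A \<rho> c \<alpha>0 :: real and x0 :: 'a
  assumes "\<Omega> \<noteq> {}" and "closed \<Omega>" and "convex \<Omega>"
    and "bdd_below (f ` \<Omega>)"
    and "\<And>x. x \<in> \<Omega> \<Longrightarrow> GDERIV f x :> g x"
    and "continuous_on \<Omega> g"
    and "L > 0"
    and "\<And>x y. x \<in> \<Omega> \<Longrightarrow> y \<in> \<Omega> \<Longrightarrow> norm (g x - g y) \<le> L * norm (x - y)"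
    and "\<epsilon>b > 0" and "\<epsilon>g > 0"
    and "\<And>e x. x \<in> \<Omega> \<Longrightarrow> \<bar>ft e x - f x\<bar> \<le> \<epsilon>b"
    and "\<And>k x. x \<in> \<Omega> \<Longrightarrow> norm (gt k x - g x) \<le> \<epsilon>g"
    and "0 < \<rho>" and "\<rho> < 1" and "0 < c" and "c < 1" and "\<alpha>0 > 0"
    and "x0 \<in> \<Omega>"
    and "\<alpha>0 + 2 * c < 1" and "\<epsilon>A > \<epsilon>b"
  shows "let x = gpls_iterate \<Omega> ft gt \<rho> c \<alpha>0 \<epsilon>A x0;
             p = (\<lambda>k. gp_direction \<Omega> \<alpha>0 (x k) (g (x k)));
             \<gamma>sq = (1 - 2 * c - \<alpha>0) * (1 - \<alpha>0) / ((1 - 2 * c - \<alpha>0) * (3 * \<alpha>0 + 1) + 2);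
             \<epsilon>bar = \<epsilon>g\<^sup>2 / \<gamma>sq
                    + 2 * \<alpha>0 * L / (c * \<rho> * (1 / 2 - \<alpha>0 / 2 - (3 * \<alpha>0 / 2 + 1 / 2) * \<gamma>sq))
                      * (\<epsilon>A + \<epsilon>b)
         in liminf (\<lambda>k. ereal \<bar>p k \<bullet> g (x k)\<bar>) \<le> ereal \<epsilon>bar"
proof -
  note \<Omega> = \<open>convex \<Omega>\<close> \<open>closed \<Omega>\<close>
  note grad = assms(5) and lip = assms(8) and noise = assms(11) and err = assms(12)
  define x where "x = gpls_iterate \<Omega> ft gt \<rho> c \<alpha>0 \<epsilon>A x0"
  define p where "p = (\<lambda>k. gp_direction \<Omega> \<alpha>0 (x k) (g (x k)))"
  define A where "A = 1 - 2 * c - \<alpha>0"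
  define M where "M = A * (3 * \<alpha>0 + 1) + 2"
  define G where "G = A * (1 - \<alpha>0) / M"
  (* The choice of G makes \<kappa> equal to (1 - \<alpha>0) / M, hence positive. *)
  define \<kappa> where "\<kappa> = 1 / 2 - \<alpha>0 / 2 - (3 * \<alpha>0 / 2 + 1 / 2) * G"
  define E where "E = \<epsilon>A + \<epsilon>b"
  define b where "b = \<epsilon>g\<^sup>2 / G + 2 * \<alpha>0 * L / (c * \<rho> * \<kappa>) * E"
  have "A > 0" using assms unfolding A_def by simp
  have "1 - \<alpha>0 > 0" using assms by simp
  have "M > 0" using \<open>A > 0\<close> \<open>\<alpha>0 > 0\<close> unfolding M_def by (simp add: add_pos_pos)
  have "G > 0" using \<open>A > 0\<close> \<open>M > 0\<close> \<open>1 - \<alpha>0 > 0\<close> unfolding G_def by simp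
  have "E > 0" using assms unfolding E_def by simp
  have GM: "G * M = A * (1 - \<alpha>0)" using \<open>M > 0\<close> unfolding G_def by simp
  have "2 * (\<kappa> * M) = (1 - \<alpha>0) * M - (3 * \<alpha>0 + 1) * (G * M)"
    unfolding \<kappa>_def by (simp add: field_simps)
  also have "\<dots> = 2 * (1 - \<alpha>0)" unfolding GM unfolding M_def by (simp add: algebra_simps)
  finally have \<kappa>M: "\<kappa> * M = 1 - \<alpha>0" by simp
  then have "\<kappa> > 0" using \<open>M > 0\<close> \<open>1 - \<alpha>0 > 0\<close> by (metis zero_less_mult_pos2)
  (* This identity singles out the value of \<gamma>sq: from r \<ge> \<epsilon>g\<^sup>2 / G and q \<ge> \<kappa> * r it yields
     A * q \<ge> \<epsilon>g\<^sup>2, the hypothesis under which short steps decrease f. *)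
  have A\<kappa>: "A * \<kappa> = G"
    using GM \<kappa>M \<open>M > 0\<close> by (metis mult.assoc mult_right_cancel less_irrefl)
  have second: "0 < 2 * \<alpha>0 * L / (c * \<rho> * \<kappa>) * E"
    using assms \<open>\<kappa> > 0\<close> \<open>E > 0\<close> by simp
  have first: "0 < \<epsilon>g\<^sup>2 / G" using \<open>G > 0\<close> \<open>\<epsilon>g > 0\<close> by simp
  have "b > 0" unfolding b_def using first second by simp

  have cont: "isCont f y" if "y \<in> \<Omega>" for y
    using grad[OF that] by (auto simp: gderiv_def intro: has_derivative_continuous)
  have x_in: "x k \<in> \<Omega>" for k
    unfolding x_def
    by (rule gpls_iterate_in_domain[OF \<Omega> cont noise \<open>\<epsilon>A > \<epsilon>b\<close> \<open>0 < \<rho>\<close> \<open>\<rho> < 1\<close> \<open>x0 \<in> \<Omega>\<close>])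

  define \<eta> where "\<eta> = min (c * min 1 (\<rho> / (\<alpha>0 * L)) * (\<kappa> * b)) (c * (\<kappa> * b) / (\<alpha>0 * L) - 2 * E)"
  have "\<eta> > 0"
  proof -
    have "2 * E < 2 * E / \<rho>" using \<open>E > 0\<close> \<open>0 < \<rho>\<close> \<open>\<rho> < 1\<close> by (simp add: field_simps)
    also have "\<dots> = c * (\<kappa> * (2 * \<alpha>0 * L / (c * \<rho> * \<kappa>) * E)) / (\<alpha>0 * L)"
      using assms \<open>\<kappa> > 0\<close> by (simp add: field_simps)
    also have "\<dots> \<le> c * (\<kappa> * b) / (\<alpha>0 * L)"
      using assms \<open>\<kappa> > 0\<close> first unfolding b_def
      by (intro divide_right_mono mult_left_mono) auto
    finally show ?thesis
      unfolding \<eta>_def using assms \<open>\<kappa> > 0\<close> \<open>b > 0\<close> by simp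
  qed

  have step: "f (x (Suc k)) \<le> f (x k) - \<eta>" if large: "b < \<bar>p k \<bullet> g (x k)\<bar>" for k
  proof -
    define d where "d = gt k (x k)"
    define p' where "p' = gp_direction \<Omega> \<alpha>0 (x k) d"
    define r where "r = - (g (x k) \<bullet> p k)"
    have "(norm (p k))\<^sup>2 \<le> \<alpha>0 * r"
      unfolding p_def r_def by (rule gp_direction_descent[OF \<Omega> x_in])
    then have "0 \<le> r"
      using \<open>\<alpha>0 > 0\<close> zero_le_power2[of "norm (p k)"] by (metis order_trans zero_le_mult_iff not_less)
    then have "b < r" using large unfolding r_def by (simp add: inner_commute)
    have d_err: "norm (d - g (x k)) \<le> \<epsilon>g" unfolding d_def by (rule err[OF x_in])
    have "\<epsilon>g\<^sup>2 / G \<le> r" using \<open>b < r\<close> second unfolding b_def by linarith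
    then have \<epsilon>G: "\<epsilon>g\<^sup>2 \<le> G * r" using \<open>G > 0\<close> by (simp add: field_simps)
    have "\<kappa> * r = (1 - \<alpha>0) / 2 * r - (3 * \<alpha>0 + 1) * (G * r) / 2"
      unfolding \<kappa>_def by (simp add: field_simps)
    also have "\<dots> \<le> (1 - \<alpha>0) / 2 * r - \<epsilon>g\<^sup>2 / 2"
    proof -
      have "1 * (G * r) \<le> (3 * \<alpha>0 + 1) * (G * r)"
        using \<open>\<alpha>0 > 0\<close> \<open>G > 0\<close> \<open>0 \<le> r\<close> by (intro mult_right_mono) auto
      then show ?thesis using \<epsilon>G by simp
    qed
    also have "\<dots> \<le> - (d \<bullet> p')"
      using gp_direction_perturbation[OF \<Omega> x_in \<open>\<alpha>0 > 0\<close> d_err] unfolding r_def p_def p'_def .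
    finally have q: "\<kappa> * r \<le> - (d \<bullet> p')" .
    have "\<epsilon>g\<^sup>2 \<le> A * (\<kappa> * r)" using \<epsilon>G A\<kappa> by (simp add: mult.assoc[symmetric])
    also have "\<dots> \<le> A * - (d \<bullet> p')" using q \<open>A > 0\<close> by (intro mult_left_mono) auto
    finally have big: "\<epsilon>g\<^sup>2 \<le> (1 - 2 * c - \<alpha>0) * - (d \<bullet> p')" unfolding A_def .
    have "\<kappa> * b \<le> - (d \<bullet> p')"
      using q \<open>b < r\<close> \<open>\<kappa> > 0\<close> by (smt (verit) mult_left_mono)
    moreover have "x (Suc k) = x k + gpls_steplength ft \<rho> c \<epsilon>A k (x k) d p' *\<^sub>R p'"
      unfolding x_def p'_def d_def by (simp add: Let_def)
    ultimately show ?thesis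
      using line_search_progress[OF \<Omega> grad lip noise \<open>\<epsilon>A > \<epsilon>b\<close> \<open>L > 0\<close> \<open>\<alpha>0 > 0\<close> \<open>0 < \<rho>\<close> \<open>\<rho> < 1\<close>
          \<open>0 < c\<close> x_in d_err big[unfolded p'_def], where Q = "\<kappa> * b" and k = k] \<open>\<kappa> > 0\<close> \<open>b > 0\<close>
      unfolding \<eta>_def E_def p'_def by simp
  qed

  have "liminf (\<lambda>k. ereal \<bar>p k \<bullet> g (x k)\<bar>) \<le> ereal b"
  proof (rule ccontr)
    assume "\<not> ?thesis"
    then have "\<forall>\<^sub>F k in sequentially. ereal b < ereal \<bar>p k \<bullet> g (x k)\<bar>"
      by (intro less_LiminfD) simp
    then obtain K where "\<And>k. K \<le> k \<Longrightarrow> b < \<bar>p k \<bullet> g (x k)\<bar>"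
      by (auto simp: eventually_sequentially)
    then have "\<not> bdd_below (range (\<lambda>k. f (x k)))"
      using step not_bdd_below_if_uniform_decrease[OF \<open>\<eta> > 0\<close>, of K "\<lambda>k. f (x k)"] by blast
    moreover have "bdd_below (range (\<lambda>k. f (x k)))"
      by (rule bdd_below_mono[OF \<open>bdd_below (f ` \<Omega>)\<close>]) (use x_in in auto)
    ultimately show False by contradiction
  qed
  then show ?thesis
    unfolding Let_def x_def[symmetric] p_def b_def E_def \<kappa>_def G_def M_def A_def .
qed

end
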